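(* Let $m$ be a non-negative integer, and let $\{r_n\}_{n\ge 0}$ be a recurringly nilpotent integer sequence of the form $$r_0,\ldots,r_{m-1},0,r_{m+1},0,\ldots,$$ that is, $r_n=0$ for all $n\in\{m+2k : k\ge 0\}$, where $r_i\neq 0$ for $0\le i<m$ and $r_{m+1}\neq 0$. Suppose that $\{r_n\}_{n\ge 0}$ has a generating polynomial $u\in\mathbb{Z}[x]$. Then, for some $\varepsilon\in\{1,-1\}$, one of the following holds: (1) $m=0$, and then $r_1$ is arbitrary (every nonzero integer occurs as $r_1$ for some such sequence); (2) $m=1$, and then either $r_0=r_2$, or $r_0=\varepsilon$; (3) $m=2$, and then either $r_3=r_1=r_0+\varepsilon$, or $r_0=2\varepsilon$, $r_1=\varepsilon$ and $r_3=3\varepsilon$; (4) $m=3$, and then $r_0=\varepsilon$, $r_1=2\varepsilon$ and $r_4=r_2=3\varepsilon$.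
   Context: For $u\in\mathbb{Z}[x]$ and a positive integer $n$, $u^{(n)}$ denotes the $n$-fold composition $u\circ\cdots\circ u$. A polynomial $u\in\mathbb{Z}[x]$ is a generating polynomial of an integer sequence $\{r_n\}_{n\ge 0}$ if $u^{(n)}(r_0)=r_n$ for all $n\ge 1$. An integer sequence $\{r_n\}_{n\ge 0}$ is recurringly nilpotent if $r_n=0$ for infinitely many $n$. *)

theory Defs
  imports "HOL-Computational_Algebra.Polynomial"
begin

definition poly_iterate :: "int poly \<Rightarrow> nat \<Rightarrow> int poly" where
  "poly_iterate u n = ((pcompose u) ^^ n) [:0, 1:]"

definition generating_polynomial :: "int poly \<Rightarrow> (nat \<Rightarrow> int) \<Rightarrow> bool" where
  "generating_polynomial u r \<longleftrightarrow> (\<forall>n\<ge>1. poly (poly_iterate u n) (r 0) = r n)"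

definition recurringly_nilpotent :: "(nat \<Rightarrow> int) \<Rightarrow> bool" where
  "recurringly_nilpotent r \<longleftrightarrow> infinite {n. r n = 0}"

text \<open>The shape \<open>r\<^sub>0, \<dots>, r\<^sub>m\<^sub>-\<^sub>1, 0, r\<^sub>m\<^sub>+\<^sub>1, 0, \<dots>\<close>. The terms at the positions
  \<open>m + 3, m + 5, \<dots>\<close> are left unconstrained.\<close>

definition alternating_zeros_from :: "nat \<Rightarrow> (nat \<Rightarrow> int) \<Rightarrow> bool" where
  "alternating_zeros_from m r \<longleftrightarrow>
     (\<forall>k. r (m + 2 * k) = 0) \<and> (\<forall>i<m. r i \<noteq> 0) \<and> r (m + 1) \<noteq> 0"

end

theory Submission
  imports Defs
begin

text \<open>Here \<open>0\<close> and \<open>c = r\<^sub>m\<^sub>+\<^sub>1\<close> form a 2-cycle of \<open>u\<close>, and \<open>r\<^sub>m\<^sub>-\<^sub>1, r\<^sub>m\<^sub>-\<^sub>2, \<dots>\<close> are successive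
  preimages of \<open>0\<close>. Splitting off linear factors at points where \<open>u\<close> takes the same value
  leaves an integer cofactor, and evaluating that at another known point makes products of
  differences of the \<open>r\<^sub>i\<close> divide \<open>1\<close> or \<open>2\<close>. This determines the preimages one at
  a time, until at the fourth step no integer is left.\<close>

section \<open>Composition powers and one-step orbits\<close>

lemma poly_poly_iterate: "poly (poly_iterate u n) x = (poly u ^^ n) x"
  unfolding poly_iterate_def by (induction n) (simp_all add: poly_pcompose)

lemma generating_polynomial_iff_Suc:
  "generating_polynomial u r \<longleftrightarrow> (\<forall>n. r (Suc n) = poly u (r n))"
proof
  assume gen: "generating_polynomial u r"
  \<comment> \<open>The definition starts at \<open>n = 1\<close>; at \<open>n = 0\<close> the empty
    iterate gives \<open>r 0\<close>.\<close>
  then have r: "r n = (poly u ^^ n) (r 0)" for n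
    by (cases n) (simp_all add: generating_polynomial_def poly_poly_iterate del: funpow.simps)
  show "\<forall>n. r (Suc n) = poly u (r n)"
  proof
    fix n
    show "r (Suc n) = poly u (r n)"
      using r[of n] r[of "Suc n"] by simp
  qed
next
  assume "\<forall>n. r (Suc n) = poly u (r n)"
  then have "(poly u ^^ n) (r 0) = r n" for n
    by (induction n) simp_all
  then show "generating_polynomial u r"
    by (simp add: generating_polynomial_def poly_poly_iterate)
qed

section \<open>Splitting off linear factors\<close>

lemma poly_factor_value:
  fixes u :: "'a::comm_ring_1 poly"
  obtains q where "\<And>x. poly u x = poly u a + (x - a) * poly q x"
proof -
  have "poly (u - [:poly u a:]) a = 0"
    by simp
  then obtain q where q: "u - [:poly u a:] = [:- a, 1:] * q"
    by (auto simp only: poly_eq_0_iff_dvd dvd_def)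
  have "poly u x = poly u a + (x - a) * poly q x" for x
    using arg_cong[OF q, of "\<lambda>p. poly p x"] by (simp add: algebra_simps)
  then show thesis
    by (rule that)
qed

lemma poly_diff_dvd:
  fixes u :: "'a::comm_ring_1 poly"
  shows "a - b dvd poly u a - poly u b"
proof -
  obtain q where "\<And>x. poly u x = poly u b + (x - b) * poly q x"
    using poly_factor_value[of u b] by blast
  from this[of a] show ?thesis
    by simp
qed

lemma poly_factor_two_values:
  fixes u :: "'a::idom poly"
  assumes "poly u a = v" "poly u b = v" "a \<noteq> b"
  obtains q where "\<And>x. poly u x = v + (x - a) * (x - b) * poly q x"
proof -
  obtain p where p: "\<And>x. poly u x = v + (x - a) * poly p x"
    using poly_factor_value[of u a] assms(1) by blast
  \<comment> \<open>At \<open>b\<close> the nonzero factor \<open>b - a\<close> cancels, so the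
    cofactor has a root there and splits again.\<close>
  have "poly p b = 0"
    using p[of b] assms by simp
  then obtain q where q: "\<And>x. poly p x = 0 + (x - b) * poly q x"
    using poly_factor_value[of p b] by metis
  show thesis
    by (rule that[of q]) (simp add: p q mult.assoc)
qed

section \<open>Small divisors and the successive preimages of \<open>0\<close>\<close>

lemma int_abs_eq_1_cases:
  fixes a :: int
  assumes "\<bar>a\<bar> = 1"
  obtains "a = 1" | "a = -1"
  using assms by linarith

lemma int_dvd_2_cases:
  fixes a :: int
  assumes "a dvd 2"
  shows "a = 1 \<or> a = -1 \<or> a = 2 \<or> a = -2"
proof -
  have "\<bar>a\<bar> \<le> 2" "a \<noteq> 0"
    using assms dvd_imp_le_int[of 2 a] by auto
  then show ?thesis
    by linarith
qed

text \<open>If \<open>a\<close> and \<open>c\<close> are distinct roots, then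
  \<open>u(x) = (x - a)(x - c) q(x)\<close>; at \<open>x = 0\<close> this reads
  \<open>c = a c q(0)\<close>, so \<open>a\<close> is a unit.\<close>

lemma first_preimage:
  fixes u :: "int poly"
  assumes cycle: "poly u 0 = c" "poly u c = 0" "c \<noteq> 0"
    and pre: "poly u a = 0"
  shows "a = c \<or> \<bar>a\<bar> = 1"
proof (cases "a = c")
  case False
  then obtain q where q: "\<And>x. poly u x = 0 + (x - a) * (x - c) * poly q x"
    using poly_factor_two_values[OF pre cycle(2)] by blast
  have "c * (a * poly q 0) = c * 1"
    using q[of 0] cycle by (simp add: algebra_simps)
  then have "a * poly q 0 = 1"
    by (simp only: mult_left_cancel[OF cycle(3)])
  then show ?thesis
    using zmult_eq_1_iff by fastforce
qed simp

lemma second_preimage: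
  fixes u :: "int poly"
  assumes cycle: "poly u 0 = c" "poly u c = 0" "c \<noteq> 0"
    and pre: "poly u a = 0" "poly u b = a" "a \<noteq> 0" "b \<noteq> 0"
  obtains e where "\<bar>e\<bar> = 1" "c = a" "a = b + e"
    | e where "\<bar>e\<bar> = 1" "b = 2 * e" "a = e" "c = 3 * e"
proof (cases "a = c")
  case True
  obtain q where q: "\<And>x. poly u x = poly u c + (x - c) * poly q x"
    using poly_factor_value[of u c] by blast
  have "c * (poly q 0 + 1) = 0"
    using q[of 0] cycle by (simp add: algebra_simps)
  then have q0: "poly q 0 = -1"
    using cycle(3) by simp
  have "b dvd poly q b + 1"
    using poly_diff_dvd[of b 0 q] q0 by simp
  then obtain k where k: "poly q b + 1 = b * k" ..
  have "c = (b - c) * poly q b"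
    using q[of b] cycle pre True by simp
  \<comment> \<open>Adding \<open>b - c\<close> to both sides of \<open>c = (b - c) q(b)\<close>
    gives \<open>b = (b - c)(q(b) + 1)\<close>, where \<open>q(b) + 1 = b k\<close>.\<close>
  then have "b * 1 = b * ((b - c) * k)"
    using arg_cong[OF k, of "\<lambda>t. (b - c) * t"] by (simp add: algebra_simps)
  then have "1 = (b - c) * k"
    by (simp only: mult_left_cancel[OF pre(4)])
  then have "\<bar>c - b\<bar> = 1"
    by (metis abs_minus_commute abs_zmult_eq_1 abs_one)
  then show thesis
    by (rule that(1)) (simp_all add: True)
next
  case False
  then have a: "\<bar>a\<bar> = 1"
    using first_preimage[OF cycle pre(1)] by simp
  obtain q where q: "\<And>x. poly u x = 0 + (x - c) * (x - a) * poly q x"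
    using poly_factor_two_values[OF cycle(2) pre(1)] False by metis
  \<comment> \<open>The product is written in two orders because \<open>abs_zmult_eq_1\<close>
    extracts only the first factor.\<close>
  have "\<bar>(b - c) * ((b - a) * poly q b)\<bar> = 1" "\<bar>(b - a) * ((b - c) * poly q b)\<bar> = 1"
    using q[of b] pre a by (simp_all add: ac_simps)
  then have "\<bar>b - c\<bar> = 1" "\<bar>b - a\<bar> = 1"
    using abs_zmult_eq_1 by blast+
  \<comment> \<open>\<open>b\<close> is a neighbour of the unit \<open>a\<close> other than
    \<open>0\<close>, and \<open>c\<close> is a neighbour of \<open>b\<close> other than
    \<open>a\<close>.\<close>
  then have "b = 2 * a" "c = 3 * a"
    using a False pre(4) by linarith+
  then show thesis
    using that(2)[of a] a by simp
qed

lemma third_preimage: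
  fixes u :: "int poly"
  assumes cycle: "poly u 0 = c" "poly u c = 0" "c \<noteq> 0"
    and pre: "poly u a = 0" "poly u b = a" "poly u d = b" "a \<noteq> 0" "b \<noteq> 0" "d \<noteq> 0"
  shows "\<bar>d\<bar> = 1 \<and> b = 2 * d \<and> a = 3 * d \<and> c = 3 * d"
  using cycle pre(1,2,4,5)
proof (cases rule: second_preimage)
  case (1 e)
  \<comment> \<open>\<open>u\<close> takes the value \<open>c\<close> at both \<open>0\<close> and
    \<open>b\<close>. At \<open>d\<close> this makes \<open>d (d - b)\<close> divide
    \<open>b - c\<close>, a unit.\<close>
  have "poly u b = c"
    using pre 1 by simp
  then obtain q where q: "\<And>x. poly u x = c + (x - 0) * (x - b) * poly q x"
    using poly_factor_two_values[OF cycle(1)] pre(5) by metis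
  have "\<bar>d * ((d - b) * poly q d)\<bar> = 1" "\<bar>(d - b) * (d * poly q d)\<bar> = 1"
    using q[of d] pre(3) 1 by (simp_all add: ac_simps)
  then have "\<bar>d\<bar> = 1" "\<bar>d - b\<bar> = 1"
    using abs_zmult_eq_1 by blast+
  \<comment> \<open>\<open>b = 2 * d\<close> and \<open>c\<close> is a neighbour of
    \<open>b\<close>; excluding \<open>d\<close> leaves \<open>c = 3 * d\<close>.\<close>
  moreover have "c \<noteq> d"
    using cycle(2) pre(3,5) by metis
  ultimately show ?thesis
    using 1 pre(5) by linarith
next
  case (2 e)
  have "c \<noteq> a"
    using 2 by auto
  then obtain q where q: "\<And>x. poly u x = 0 + (x - c) * (x - a) * poly q x"
    using poly_factor_two_values[OF cycle(2) pre(1)] by metis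
  have "(d - c) * (d - a) * poly q d = 2 * e"
    using q[of d] pre 2 by simp
  then have "(d - c) * (d - a) dvd 2 * e"
    by (metis dvd_triv_left)
  then have dvd: "(d - c) * (d - a) dvd 2"
    using 2(1) by (auto elim: int_abs_eq_1_cases)
  \<comment> \<open>The divisors \<open>d - a\<close> and \<open>d - c\<close> of \<open>2\<close>
    differ by \<open>2 * e\<close>, so they are \<open>e\<close> and \<open>-e\<close>. Hence
    \<open>d = b\<close>, which is absurd: \<open>u\<close> sends \<open>d\<close> to
    \<open>2 * e\<close> but \<open>b\<close> to \<open>e\<close>.\<close>
  then have "d - c = 1 \<or> d - c = -1 \<or> d - c = 2 \<or> d - c = -2"
    using int_dvd_2_cases dvd_mult_left by blast
  moreover have "d - a = 1 \<or> d - a = -1 \<or> d - a = 2 \<or> d - a = -2"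
    using int_dvd_2_cases dvd dvd_mult_right by blast
  moreover have "d \<noteq> b"
    using pre 2 by auto
  ultimately show ?thesis
    using 2 pre(6) by (elim disjE int_abs_eq_1_cases) simp_all
qed

text \<open>Differences of arguments divide differences of values: \<open>f - c\<close> divides the
  unit \<open>d\<close>, and \<open>f\<close> divides \<open>d - c = -2 * d\<close>. Only
  \<open>f = 2 * d = b\<close> survives, but \<open>u\<close> sends \<open>b\<close> to
  \<open>3 * d\<close>, not \<open>d\<close>.\<close>

lemma no_fourth_preimage:
  fixes u :: "int poly"
  assumes cycle: "poly u 0 = c" "poly u c = 0" "c \<noteq> 0"
    and pre: "poly u a = 0" "poly u b = a" "poly u d = b" "poly u f = d"
      "a \<noteq> 0" "b \<noteq> 0" "d \<noteq> 0"
  shows False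
proof -
  have d: "\<bar>d\<bar> = 1" "b = 2 * d" "a = 3 * d" "c = 3 * d"
    using third_preimage[OF cycle pre(1-3,5-7)] by simp_all
  have "f - c dvd d" "f - 0 dvd d - c"
    using poly_diff_dvd[of f c u] poly_diff_dvd[of f 0 u] cycle pre by simp_all
  then have "f - c dvd 1" "f dvd 2"
    using d by (auto elim: int_abs_eq_1_cases)
  then have "\<bar>f - c\<bar> = 1" "f = 1 \<or> f = -1 \<or> f = 2 \<or> f = -2"
    using int_dvd_2_cases by simp_all
  then have "f = b"
    using d by linarith
  then show False
    using pre(2,4) d by simp
qed

section \<open>Classification by \<open>m\<close>, and realizability for
  \<open>m = 0\<close>\<close>

lemma generated_alternating_cases:
  fixes u :: "int poly"
  assumes gen: "generating_polynomial u r" and alt: "alternating_zeros_from m r"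
  obtains "m = 0"
    | "m = 1" "r 0 = r 2 \<or> \<bar>r 0\<bar> = 1"
    | e where "m = 2" "\<bar>e\<bar> = 1" "r 3 = r 1" "r 1 = r 0 + e"
    | e where "m = 2" "\<bar>e\<bar> = 1" "r 0 = 2 * e" "r 1 = e" "r 3 = 3 * e"
    | "m = 3" "\<bar>r 0\<bar> = 1" "r 1 = 2 * r 0" "r 2 = 3 * r 0" "r 4 = 3 * r 0"
proof -
  have step: "poly u (r n) = r (Suc n)" for n
    using gen by (simp add: generating_polynomial_iff_Suc)
  \<comment> \<open>The zeros at \<open>m\<close> and \<open>m + 2\<close> close the 2-cycle with
    \<open>c = r (Suc m)\<close>.\<close>
  have "r m = 0" "r (Suc (Suc m)) = 0"
    using alt spec[of "\<lambda>k. r (m + 2 * k) = 0" 0] spec[of "\<lambda>k. r (m + 2 * k) = 0" 1]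
    by (simp_all add: alternating_zeros_from_def)
  then have cycle: "poly u 0 = r (Suc m)" "poly u (r (Suc m)) = 0" "r (Suc m) \<noteq> 0"
    using step[of m] step[of "Suc m"] alt by (simp_all add: alternating_zeros_from_def)
  have nz: "r i \<noteq> 0" if "i < m" for i
    using alt that by (simp add: alternating_zeros_from_def)
  \<comment> \<open>From \<open>m = 4\<close> on, the four terms before the first zero form a
    forbidden chain of preimages.\<close>
  consider "m = 0" | "m = 1" | "m = 2" | "m = 3" | k where "m = Suc (Suc (Suc (Suc k)))"
    by (metis One_nat_def Suc_1 numeral_3_eq_3 not0_implies_Suc)
  then show thesis
  proof cases
    case 1
    then show thesis by (rule that(1))
  next
    case 2
    then show thesis
      using first_preimage[OF cycle, of "r 0"] step \<open>r m = 0\<close> that(2)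
      by (simp add: numeral_eq_Suc)
  next
    case 3
    have pre: "poly u (r 1) = 0" "poly u (r 0) = r 1" "r 1 \<noteq> 0" "r 0 \<noteq> 0"
      using 3 step nz \<open>r m = 0\<close> by (simp_all add: numeral_eq_Suc)
    show thesis
      using second_preimage[OF cycle pre] that(3,4) 3 by (simp add: numeral_eq_Suc) metis
  next
    case 4
    have pre: "poly u (r 2) = 0" "poly u (r 1) = r 2" "poly u (r 0) = r 1"
      "r 2 \<noteq> 0" "r 1 \<noteq> 0" "r 0 \<noteq> 0"
      using 4 step nz \<open>r m = 0\<close> by (simp_all add: numeral_eq_Suc)
    show thesis
      using third_preimage[OF cycle pre] that(5) 4 by (simp add: numeral_eq_Suc)
  next
    case (5 k)
    have "poly u (r (Suc (Suc (Suc k)))) = 0"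
      using step 5 \<open>r m = 0\<close> by simp
    from no_fourth_preimage[OF cycle this step step step] show thesis
      using nz 5 by simp
  qed
qed

lemma alternating_zeros_realizable:
  fixes c :: int
  assumes "c \<noteq> 0"
  shows "\<exists>r. recurringly_nilpotent r \<and> alternating_zeros_from 0 r \<and>
    (\<exists>u. generating_polynomial u r) \<and> r 1 = c"
proof -
  define r where "r n = (if even n then 0 else c)" for n :: nat
  \<comment> \<open>The reflection \<open>x \<mapsto> c - x\<close> swaps \<open>0\<close> and
    \<open>c\<close>.\<close>
  have "generating_polynomial [:c, -1:] r"
    by (simp add: generating_polynomial_iff_Suc r_def)
  moreover have "{n. r n = 0} = range ((*) 2)"
    using assms by (auto simp: r_def elim: evenE)
  then have "recurringly_nilpotent r"
    by (simp add: recurringly_nilpotent_def range_inj_infinite inj_def)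
  moreover have "alternating_zeros_from 0 r" "r 1 = c"
    using assms by (simp_all add: alternating_zeros_from_def r_def)
  ultimately show ?thesis
    by blast
qed

theorem theorem4p10:
  "(\<forall>(m::nat) (r::nat \<Rightarrow> int).
      recurringly_nilpotent r \<and> alternating_zeros_from m r \<and>
      (\<exists>u::int poly. generating_polynomial u r) \<longrightarrow>
      (\<exists>\<epsilon>\<in>{1, -1::int}.
          m = 0
        \<or> (m = 1 \<and> (r 0 = r 2 \<or> r 0 = \<epsilon>))
        \<or> (m = 2 \<and> ((r 3 = r 1 \<and> r 1 = r 0 + \<epsilon>) \<or>
                    (r 0 = 2 * \<epsilon> \<and> r 1 = \<epsilon> \<and> r 3 = 3 * \<epsilon>)))
        \<or> (m = 3 \<and> r 0 = \<epsilon> \<and> r 1 = 2 * \<epsilon> \<and> r 4 = r 2 \<and> r 2 = 3 * \<epsilon>)))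
   \<and> (\<forall>c::int. c \<noteq> 0 \<longrightarrow>
        (\<exists>r::nat \<Rightarrow> int.
            recurringly_nilpotent r \<and> alternating_zeros_from 0 r \<and>
            (\<exists>u::int poly. generating_polynomial u r) \<and> r 1 = c))"
proof (intro conjI allI impI, goal_cases)
  case (1 m r)
  then obtain u where "generating_polynomial u r" "alternating_zeros_from m r"
    by blast
  then show ?case
    by (cases rule: generated_alternating_cases) (auto elim!: int_abs_eq_1_cases)
next
  case (2 c)
  then show ?case
    by (rule alternating_zeros_realizable)
qed

end
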